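(* Let points $M_1,\dots,M_N\in\mathbb R^k$ with masses $m_1,\dots,m_N>0$ be given, not all contained in one hyperplane, with total mass $m$, center of masses $C$, and central principal hyperplanar moments of inertia $0<J_1<J_2<\dots<J_k$. Use Cartesian coordinates with origin $C$ along the principal axes at $C$. For a real number $\mu$ consider the family of hyperplanes $\pi$ for which the hyperplanar moment of inertia is $J_\pi=\mu$. Then all the hyperplanes of this family which do not contain the origin form a quadric (in the space of hyperplanes). By varying $\mu$, the resulting quadrics form a linear pencil of quadrics, and this linear pencil is dual to the confocal pencil $$\frac{x_1^2}{\frac{J_1}{m}-\lambda}+\frac{x_2^2}{\frac{J_1}{m}-a_2^2-\lambda}+\dots+\frac{x_k^2}{\frac{J_1}{m}-a_k^2-\lambda}=1,\qquad a_s^2=\frac{J_s-J_1}{m},\ s=2,\dots,k.$$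
   Context: For a hyperplane $\pi$, the hyperplanar moment of inertia is $J_\pi=\sum_{i=1}^N m_i d_i^2$, where $d_i$ is the perpendicular distance from $M_i$ to $\pi$. The central hyperplanar operator of inertia $J_C$ is the symmetric operator with $\langle J_C\mathbf n_1,\mathbf n_2\rangle=\sum_{j} m_j\langle \mathbf r_j,\mathbf n_1\rangle\langle\mathbf r_j,\mathbf n_2\rangle$, $\mathbf r_j=M_j-C$. Its eigenvalues $J_1,\dots,J_k$ are the central principal hyperplanar moments of inertia, and its orthonormal eigenvectors give the principal axes at $C$ (the $x_i$-axis corresponds to $J_i$). A hyperplane not containing the origin is written uniquely as $\beta_1x_1+\dots+\beta_kx_k=1$ with $\beta\neq0$; $(\beta_1,\dots,\beta_k)$ are used as coordinates on the space of such hyperplanes, and "a set of hyperplanes forms a quadric" means that it is given by a (possibly degenerate or empty) quadratic equation in $\beta$. A linear pencil of quadrics is a one-parameter family $\{Q_0(\beta)+tQ_1(\beta)=0\}$ with $Q_0,Q_1$ fixed quadratic polynomials. The dual of a nondegenerate quadric in $\mathbb R^k$ is the quadric in the space of hyperplanes consisting of its tangent hyperplanes; the linear pencil is dual to the confocal pencil when the duals of the nondegenerate confocal quadrics are the corresponding members of the linear pencil. *)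

theory Defs
  imports "HOL-Analysis.Analysis"
begin

section \<open>Moments of inertia of a system of weighted points\<close>

text \<open>The points are \<open>M 1, \<dots>, M N\<close> with masses \<open>m 1, \<dots>, m N\<close>;
  the ambient space \<open>real^'n\<close> has dimension \<open>k = CARD('n)\<close>.\<close>

definition total_mass :: "nat \<Rightarrow> (nat \<Rightarrow> real) \<Rightarrow> real" where
  "total_mass N m = (\<Sum>j=1..N. m j)"

definition center_of_mass :: "nat \<Rightarrow> (nat \<Rightarrow> real) \<Rightarrow> (nat \<Rightarrow> real^'n) \<Rightarrow> real^'n" where
  "center_of_mass N m M = (1 / total_mass N m) *\<^sub>R (\<Sum>j=1..N. m j *\<^sub>R M j)"

definition is_hyperplane :: "(real^'n) set \<Rightarrow> bool" where
  "is_hyperplane \<pi> \<longleftrightarrow> (\<exists>a b. a \<noteq> 0 \<and> \<pi> = {X. a \<bullet> X = b})"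

definition hyperplanar_moment ::
  "nat \<Rightarrow> (nat \<Rightarrow> real) \<Rightarrow> (nat \<Rightarrow> real^'n) \<Rightarrow> (real^'n) set \<Rightarrow> real" where
  "hyperplanar_moment N m M \<pi> = (\<Sum>j=1..N. m j * (infdist (M j) \<pi>)\<^sup>2)"

definition central_operator ::
  "nat \<Rightarrow> (nat \<Rightarrow> real) \<Rightarrow> (nat \<Rightarrow> real^'n) \<Rightarrow> real^'n \<Rightarrow> real^'n" where
  "central_operator N m M =
    (THE A. linear A \<and> (\<forall>u v. A u \<bullet> v = u \<bullet> A v) \<and>
      (\<forall>u v. A u \<bullet> v =
        (\<Sum>j=1..N. m j * ((M j - center_of_mass N m M) \<bullet> u) * ((M j - center_of_mass N m M) \<bullet> v))))"

lemma operator_of_form_iff: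
  fixes r :: "nat \<Rightarrow> real^'n"
  shows "linear A \<and> (\<forall>u v. A u \<bullet> v = u \<bullet> A v) \<and>
      (\<forall>u v. A u \<bullet> v = (\<Sum>j=1..N. m j * (r j \<bullet> u) * (r j \<bullet> v))) \<longleftrightarrow>
    A = (\<lambda>u. \<Sum>j=1..N. (m j * (r j \<bullet> u)) *\<^sub>R r j)" (is "?L \<longleftrightarrow> A = ?A")
proof
  have form: "?A u \<bullet> v = (\<Sum>j=1..N. m j * (r j \<bullet> u) * (r j \<bullet> v))" for u v
    by (simp add: inner_sum_left)
  show "A = ?A" if ?L
  proof
    fix u
    have "\<forall>v. A u \<bullet> v = ?A u \<bullet> v"
      unfolding form using that by blast
    then show "A u = ?A u"
      by (rule vector_eq_rdot[THEN iffD1])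
  qed
  assume A: "A = ?A"
  have "linear A"
    unfolding A
    by (rule linearI)
      (simp_all add: inner_add_right distrib_left scaleR_add_left sum.distrib scaleR_sum_right mult.left_commute)
  moreover have A_form: "A u \<bullet> v = (\<Sum>j=1..N. m j * (r j \<bullet> u) * (r j \<bullet> v))" for u v
    unfolding A by (rule form)
  moreover have "A u \<bullet> v = u \<bullet> A v" for u v
    unfolding inner_commute[of u "A v"] A_form by (rule sum.cong) simp_all
  ultimately show ?L
    by (intro conjI allI)
qed

lemma central_operator_eq:
  "central_operator N m M =
    (\<lambda>u. \<Sum>j=1..N. (m j * ((M j - center_of_mass N m M) \<bullet> u)) *\<^sub>R (M j - center_of_mass N m M))"
  unfolding central_operator_def operator_of_form_iff by (rule the_eq_trivial)

text \<open>\<open>J s\<close> is the eigenvalue belonging to the axis with direction \<open>e s\<close>.\<close>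

definition principal_axes ::
  "nat \<Rightarrow> (nat \<Rightarrow> real) \<Rightarrow> (nat \<Rightarrow> real^'n) \<Rightarrow> ('n \<Rightarrow> real) \<Rightarrow> ('n \<Rightarrow> real^'n) \<Rightarrow> bool" where
  "principal_axes N m M J e \<longleftrightarrow>
    (\<forall>s t. e s \<bullet> e t = (if s = t then 1 else 0)) \<and>
    (\<forall>s. central_operator N m M (e s) = J s *\<^sub>R e s)"

section \<open>Quadrics in the space of hyperplanes\<close>

text \<open>Cartesian coordinates of a point with respect to the origin \<open>C\<close> and the frame \<open>e\<close>.\<close>

definition coords :: "real^'n \<Rightarrow> ('n \<Rightarrow> real^'n) \<Rightarrow> real^'n \<Rightarrow> real^'n" where
  "coords C e X = (\<chi> s. (X - C) \<bullet> e s)"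

definition hyperplane_of :: "real^'n \<Rightarrow> ('n \<Rightarrow> real^'n) \<Rightarrow> real^'n \<Rightarrow> (real^'n) set" where
  "hyperplane_of C e \<beta> = {X. (\<Sum>s\<in>UNIV. \<beta> $ s * coords C e X $ s) = 1}"

text \<open>\<open>A\<close> being symmetric, \<open>A \<noteq> 0\<close> says that the degree is exactly two.\<close>

definition quadratic_polynomial :: "(real^'n \<Rightarrow> real) \<Rightarrow> bool" where
  "quadratic_polynomial Q \<longleftrightarrow>
    (\<exists>(A :: real^'n^'n) b c. transpose A = A \<and> A \<noteq> 0 \<and> Q = (\<lambda>x. x \<bullet> (A *v x) + b \<bullet> x + c))"

text \<open>The set of hyperplanes given by the equation \<open>Q \<beta> = 0\<close>; no hyperplane has \<open>\<beta> = 0\<close>.\<close>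

definition hyperplane_locus ::
  "real^'n \<Rightarrow> ('n \<Rightarrow> real^'n) \<Rightarrow> (real^'n \<Rightarrow> real) \<Rightarrow> (real^'n) set set" where
  "hyperplane_locus C e Q = hyperplane_of C e ` {\<beta>. \<beta> \<noteq> 0 \<and> Q \<beta> = 0}"

definition forms_quadric ::
  "real^'n \<Rightarrow> ('n \<Rightarrow> real^'n) \<Rightarrow> (real^'n) set set \<Rightarrow> bool" where
  "forms_quadric C e S \<longleftrightarrow> (\<exists>Q. quadratic_polynomial Q \<and> S = hyperplane_locus C e Q)"

text \<open>Linear independence ensures that the family \<open>Q0 + t Q1\<close> really depends on \<open>t\<close>.\<close>

definition spans_linear_pencil :: "(real^'n \<Rightarrow> real) \<Rightarrow> (real^'n \<Rightarrow> real) \<Rightarrow> bool" where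
  "spans_linear_pencil Q0 Q1 \<longleftrightarrow> quadratic_polynomial Q0 \<and> quadratic_polynomial Q1 \<and>
    (\<forall>u v. (\<forall>\<beta>. u * Q0 \<beta> + v * Q1 \<beta> = 0) \<longrightarrow> u = 0 \<and> v = 0)"

definition pencil_member ::
  "(real^'n \<Rightarrow> real) \<Rightarrow> (real^'n \<Rightarrow> real) \<Rightarrow> real \<Rightarrow> real^'n \<Rightarrow> real" where
  "pencil_member Q0 Q1 t = (\<lambda>\<beta>. Q0 \<beta> + t * Q1 \<beta>)"

text \<open>The tangent hyperplanes of the hypersurface \<open>f = 0\<close> at its regular points. All real points
  of a nondegenerate quadric are regular, so this is then its dual.\<close>

definition tangent_hyperplanes :: "(real^'n \<Rightarrow> real) \<Rightarrow> (real^'n) set set" where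
  "tangent_hyperplanes f =
    {\<pi>. \<exists>P g. f P = 0 \<and> GDERIV f P :> g \<and> g \<noteq> 0 \<and> \<pi> = {X. g \<bullet> (X - P) = 0}}"

section \<open>The confocal pencil\<close>

text \<open>The index type is linearly ordered; its least element plays the role of the index 1.\<close>

definition first_axis :: "'n::{finite,linorder}" where
  "first_axis = Min UNIV"

definition confocal_denominator ::
  "real \<Rightarrow> ('n::{finite,linorder} \<Rightarrow> real) \<Rightarrow> real \<Rightarrow> 'n \<Rightarrow> real" where
  "confocal_denominator \<alpha> a l s =
    (if s = first_axis then \<alpha> - l else \<alpha> - (a s)\<^sup>2 - l)"

definition confocal_polynomial ::
  "(real, 'n::{finite,linorder}) vec \<Rightarrow> ('n \<Rightarrow> (real, 'n) vec) \<Rightarrow> real \<Rightarrow> ('n \<Rightarrow> real) \<Rightarrow> real \<Rightarrow>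
    (real, 'n) vec \<Rightarrow> real" where
  "confocal_polynomial C e \<alpha> a l X =
    (\<Sum>s\<in>UNIV. (coords C e X $ s)\<^sup>2 / confocal_denominator \<alpha> a l s) - 1"

text \<open>The condition also keeps all divisions meaningful: in HOL, \<open>x / 0 = 0\<close>.\<close>

definition confocal_nondegenerate ::
  "real \<Rightarrow> ('n::{finite,linorder} \<Rightarrow> real) \<Rightarrow> real \<Rightarrow> bool" where
  "confocal_nondegenerate \<alpha> a l \<longleftrightarrow> (\<forall>s. confocal_denominator \<alpha> a l s \<noteq> 0)"

end

theory Submission
  imports Defs
begin

text \<open>
  Write a hyperplane off the centre of masses \<open>C\<close> as \<open>n \<bullet> (X - C) = 1\<close>, where
  \<open>n = \<Sum>s. \<beta> $ s *\<^sub>R e s\<close> is its normal vector in the frame of principal axes. The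
  distance from \<open>M j\<close> is \<open>\<bar>n \<bullet> r j - 1\<bar> / \<bar>n\<bar>\<close> with \<open>r j = M j - C\<close>. When the squares of the
  numerators are weighted by the masses and added, the cross terms vanish because
  \<open>\<Sum>j. m j *\<^sub>R r j = 0\<close>, and the quadratic terms are diagonal because the axes are principal.
  So the moment is \<open>(\<Sum>s. J s * \<beta>\<^sub>s\<^sup>2 + mass) / (\<Sum>s. \<beta>\<^sub>s\<^sup>2)\<close>
  (\<open>hyperplanar_moment_hyperplane_of\<close>), and the condition that it be equal to \<open>\<mu>\<close> reads
  \<open>(\<Sum>s. J s * \<beta>\<^sub>s\<^sup>2 + mass) - \<mu> * (\<Sum>s. \<beta>\<^sub>s\<^sup>2) = 0\<close>,
  which is quadratic in \<open>\<beta>\<close> and affine in \<open>\<mu>\<close>: a linear pencil.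

  On the dual side, the tangent hyperplane of \<open>\<Sum>s. x\<^sub>s\<^sup>2 / D s = 1\<close> at \<open>x\<close> has the coordinates
  \<open>\<beta>\<^sub>s = x\<^sub>s / D s\<close>, so the dual quadric is \<open>\<Sum>s. D s * \<beta>\<^sub>s\<^sup>2 = 1\<close>
  (\<open>tangent_hyperplanes_diagonal\<close>). The confocal denominators satisfy
  \<open>mass * D s = \<mu> - J s\<close> with \<open>\<mu> = 2 * J first_axis - mass * l\<close>, and the two equations in \<open>\<beta>\<close>
  become proportional.
\<close>

section \<open>Hyperplanes in an orthonormal frame\<close>

lemma infdist_hyperplane:
  fixes a Y :: "'a::real_inner"
  assumes "a \<noteq> 0"
  shows "infdist Y {X. a \<bullet> X = b} = \<bar>a \<bullet> Y - b\<bar> / norm a"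
proof (rule antisym)
  \<comment> \<open>The foot of the perpendicular from \<open>Y\<close>.\<close>
  define F where "F = Y - ((a \<bullet> Y - b) / (a \<bullet> a)) *\<^sub>R a"
  have F: "F \<in> {X. a \<bullet> X = b}"
    using assms by (simp add: F_def inner_diff_right)
  have "dist Y F = \<bar>a \<bullet> Y - b\<bar> / norm a"
    using assms by (simp add: F_def dist_norm dot_square_norm power2_eq_square)
  then show "infdist Y {X. a \<bullet> X = b} \<le> \<bar>a \<bullet> Y - b\<bar> / norm a"
    using infdist_le[OF F, of Y] by simp
  have "\<bar>a \<bullet> Y - b\<bar> / norm a \<le> dist Y X" if "a \<bullet> X = b" for X
  proof -
    have "\<bar>a \<bullet> Y - b\<bar> = \<bar>a \<bullet> (Y - X)\<bar>"
      using that by (simp add: inner_diff_right)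
    also have "\<dots> \<le> norm a * dist Y X"
      unfolding dist_norm by (rule Cauchy_Schwarz_ineq2)
    finally show ?thesis
      using assms by (simp add: divide_le_eq mult.commute)
  qed
  then show "\<bar>a \<bullet> Y - b\<bar> / norm a \<le> infdist Y {X. a \<bullet> X = b}"
    using F unfolding infdist_def by (auto intro!: cINF_greatest)
qed

definition orthonormal_frame :: "('n \<Rightarrow> real^'n) \<Rightarrow> bool" where
  "orthonormal_frame e \<longleftrightarrow> (\<forall>s t. e s \<bullet> e t = (if s = t then 1 else 0))"

definition frame_vector :: "('n \<Rightarrow> real^'n) \<Rightarrow> real^'n \<Rightarrow> real^'n" where
  "frame_vector e \<beta> = (\<Sum>s\<in>UNIV. (\<beta> $ s) *\<^sub>R e s)"

lemma linear_frame_vector: "linear (frame_vector e)"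
  by (rule linearI)
    (simp_all add: frame_vector_def scaleR_add_left sum.distrib scaleR_sum_right)

lemma frame_vector_inner:
  "frame_vector e \<beta> \<bullet> x = (\<Sum>s\<in>UNIV. \<beta> $ s * (x \<bullet> e s))"
  by (simp add: frame_vector_def inner_sum_left inner_commute[of x])

lemma frame_vector_component:
  assumes "orthonormal_frame e"
  shows "frame_vector e \<beta> \<bullet> e t = \<beta> $ t"
  using assms
  by (simp add: frame_vector_inner orthonormal_frame_def if_distrib[of "\<lambda>x. _ * x"] cong: if_cong)

text \<open>The components recover \<open>\<beta>\<close>, so \<open>frame_vector e\<close> is injective, and an injective
  endomorphism of a finite-dimensional space is surjective.\<close>

lemma frame_vector_expansion:
  assumes "orthonormal_frame e"
  shows "frame_vector e (\<chi> s. x \<bullet> e s) = x"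
proof -
  have "inj (frame_vector e)"
    by (rule injI) (metis assms frame_vector_component vec_eq_iff)
  then have "surj (frame_vector e)"
    using linear_frame_vector linear_injective_imp_surjective by blast
  then obtain \<beta> where "x = frame_vector e \<beta>"
    by (metis surjD)
  moreover have "(\<chi> s. frame_vector e \<beta> \<bullet> e s) = \<beta>"
    by (simp add: frame_vector_component[OF assms] vec_eq_iff)
  ultimately show ?thesis
    by simp
qed

lemma frame_vector_inner_self:
  assumes "orthonormal_frame e"
  shows "frame_vector e \<beta> \<bullet> frame_vector e \<beta> = (\<Sum>s\<in>UNIV. (\<beta> $ s)\<^sup>2)"
  using assms
  by (simp add: frame_vector_inner[of _ _ "frame_vector e \<beta>"] frame_vector_component power2_eq_square)

lemma sum_squares_components_pos:
  fixes \<beta> :: "real^'n"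
  assumes "\<beta> \<noteq> 0"
  shows "(\<Sum>s\<in>UNIV. (\<beta> $ s)\<^sup>2) > 0"
proof -
  have "\<beta> \<bullet> \<beta> > 0"
    using assms by simp
  then show ?thesis
    by (simp add: inner_vec_def power2_eq_square)
qed

lemma frame_vector_eq_0_iff:
  assumes "orthonormal_frame e"
  shows "frame_vector e \<beta> = 0 \<longleftrightarrow> \<beta> = 0"
  using frame_vector_inner_self[OF assms, of \<beta>] sum_squares_components_pos[of \<beta>]
    linear_0[OF linear_frame_vector, of e]
  by fastforce

lemma hyperplane_of_eq:
  "hyperplane_of C e \<beta> = {X. frame_vector e \<beta> \<bullet> (X - C) = 1}"
  by (simp add: hyperplane_of_def coords_def frame_vector_inner)

lemma hyperplane_of_eq_affine:
  "hyperplane_of C e \<beta> = {X. frame_vector e \<beta> \<bullet> X = 1 + frame_vector e \<beta> \<bullet> C}"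
  by (auto simp: hyperplane_of_eq inner_diff_right)

lemma hyperplanes_off_origin:
  assumes "orthonormal_frame e"
  shows "{\<pi>. is_hyperplane \<pi> \<and> C \<notin> \<pi>} = hyperplane_of C e ` {\<beta>. \<beta> \<noteq> 0}"
proof (intro equalityI subsetI)
  fix \<pi> assume "\<pi> \<in> {\<pi>. is_hyperplane \<pi> \<and> C \<notin> \<pi>}"
  then obtain a b where a: "a \<noteq> 0" and \<pi>: "\<pi> = {X. a \<bullet> X = b}" and C: "a \<bullet> C \<noteq> b"
    unfolding is_hyperplane_def by auto
  \<comment> \<open>The normal vector is scaled so that the equation takes the value 1 relative to \<open>C\<close>.\<close>
  define c where "c = b - a \<bullet> C"
  have c: "c \<noteq> 0"
    using C by (simp add: c_def)
  define \<beta> where "\<beta> = (\<chi> s. ((1 / c) *\<^sub>R a) \<bullet> e s)"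
  have \<beta>: "frame_vector e \<beta> = (1 / c) *\<^sub>R a"
    unfolding \<beta>_def by (rule frame_vector_expansion[OF assms])
  have "\<beta> \<noteq> 0"
    using \<beta> a c frame_vector_eq_0_iff[OF assms, of \<beta>] by auto
  moreover have "\<pi> = hyperplane_of C e \<beta>"
  proof -
    have "((1 / c) *\<^sub>R a) \<bullet> (X - C) = 1 \<longleftrightarrow> a \<bullet> X = b" for X
    proof -
      have "((1 / c) *\<^sub>R a) \<bullet> (X - C) = 1 \<longleftrightarrow> a \<bullet> (X - C) = c"
        using c by auto
      also have "\<dots> \<longleftrightarrow> a \<bullet> X = b"
        by (auto simp: c_def inner_diff_right)
      finally show ?thesis .
    qed
    then show ?thesis
      unfolding \<pi> hyperplane_of_eq \<beta> by simp
  qed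
  ultimately show "\<pi> \<in> hyperplane_of C e ` {\<beta>. \<beta> \<noteq> 0}"
    by blast
next
  fix \<pi> assume "\<pi> \<in> hyperplane_of C e ` {\<beta>. \<beta> \<noteq> 0}"
  then obtain \<beta> where \<beta>: "\<beta> \<noteq> 0" and \<pi>: "\<pi> = hyperplane_of C e \<beta>"
    by auto
  have "is_hyperplane \<pi>"
    unfolding is_hyperplane_def \<pi> hyperplane_of_eq_affine
    using \<beta> frame_vector_eq_0_iff[OF assms] by blast
  moreover have "C \<notin> \<pi>"
    by (simp add: \<pi> hyperplane_of_eq)
  ultimately show "\<pi> \<in> {\<pi>. is_hyperplane \<pi> \<and> C \<notin> \<pi>}"
    by simp
qed

section \<open>The moment of inertia in the hyperplane coordinates\<close>

lemma total_mass_pos: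
  fixes M :: "nat \<Rightarrow> real^'n"
  assumes "\<And>j. j \<in> {1..N} \<Longrightarrow> m j > 0"
    and "\<not> (\<exists>\<pi>. is_hyperplane \<pi> \<and> (\<forall>j\<in>{1..N}. M j \<in> \<pi>))"
  shows "total_mass N m > 0"
proof -
  have "is_hyperplane {X :: real^'n. axis undefined 1 \<bullet> X = 0}"
    unfolding is_hyperplane_def by (metis axis_eq_0_iff zero_neq_one)
  \<comment> \<open>Without points, any hyperplane would contain them all.\<close>
  with assms(2) have "{1..N} \<noteq> {}"
    by blast
  then show ?thesis
    unfolding total_mass_def by (intro sum_pos assms(1)) auto
qed

lemma sum_moments_about_center:
  assumes "total_mass N m \<noteq> 0"
  shows "(\<Sum>j=1..N. m j *\<^sub>R (M j - center_of_mass N m M)) = 0"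
proof -
  have "(\<Sum>j=1..N. m j *\<^sub>R center_of_mass N m M) = total_mass N m *\<^sub>R center_of_mass N m M"
    by (simp add: total_mass_def scaleR_sum_left)
  also have "\<dots> = (\<Sum>j=1..N. m j *\<^sub>R M j)"
    using assms by (simp add: center_of_mass_def)
  finally show ?thesis
    by (simp add: scaleR_diff_right sum_subtractf)
qed

text \<open>Expanding the square, the linear term is the moment of masses about their centre, which
  is 0; this is the parallel-axis argument.\<close>

lemma sum_squares_about_center:
  fixes M :: "nat \<Rightarrow> real^'n"
  assumes "total_mass N m \<noteq> 0"
  defines "C \<equiv> center_of_mass N m M"
  shows "(\<Sum>j=1..N. m j * (n \<bullet> (M j - C) - 1)\<^sup>2) =
    central_operator N m M n \<bullet> n + total_mass N m"
proof -
  have "(\<Sum>j=1..N. m j * (n \<bullet> (M j - C))) = n \<bullet> (\<Sum>j=1..N. m j *\<^sub>R (M j - C))"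
    by (simp add: inner_sum_right)
  also have "\<dots> = 0"
    using sum_moments_about_center[OF assms(1), of M] by (simp add: C_def)
  finally have linear_term: "(\<Sum>j=1..N. m j * (n \<bullet> (M j - C))) = 0" .
  have "c * (t - 1)\<^sup>2 = c * t\<^sup>2 - 2 * (c * t) + c" for c t :: real
    by (simp add: power2_diff algebra_simps)
  then have "(\<Sum>j=1..N. m j * (n \<bullet> (M j - C) - 1)\<^sup>2) =
    (\<Sum>j=1..N. m j * (n \<bullet> (M j - C))\<^sup>2 - 2 * (m j * (n \<bullet> (M j - C))) + m j)"
    by simp
  also have "\<dots> = (\<Sum>j=1..N. m j * (n \<bullet> (M j - C))\<^sup>2) + total_mass N m"
    using linear_term
    by (simp add: sum.distrib sum_subtractf sum_distrib_left[symmetric] total_mass_def)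
  also have "(\<Sum>j=1..N. m j * (n \<bullet> (M j - C))\<^sup>2) = central_operator N m M n \<bullet> n"
    by (simp add: central_operator_eq C_def inner_sum_left inner_commute[of n] power2_eq_square mult.assoc)
  finally show ?thesis .
qed

lemma central_operator_diagonal:
  assumes axes: "principal_axes N m M J e"
  shows "central_operator N m M (frame_vector e \<beta>) \<bullet> frame_vector e \<beta> =
    (\<Sum>s\<in>UNIV. J s * (\<beta> $ s)\<^sup>2)"
proof -
  have frame: "orthonormal_frame e" and eig: "\<And>s. central_operator N m M (e s) = J s *\<^sub>R e s"
    using axes by (simp_all add: principal_axes_def orthonormal_frame_def)
  have lin: "linear (central_operator N m M)"
    using operator_of_form_iff[of "central_operator N m M" m "\<lambda>j. M j - center_of_mass N m M" N]
      central_operator_eq[of N m M] by blast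
  have "central_operator N m M (frame_vector e \<beta>) = (\<Sum>s\<in>UNIV. (\<beta> $ s * J s) *\<^sub>R e s)"
    by (simp add: frame_vector_def linear_sum[OF lin] linear_scale[OF lin] eig)
  then have "central_operator N m M (frame_vector e \<beta>) \<bullet> frame_vector e \<beta> =
      (\<Sum>s\<in>UNIV. (\<beta> $ s * J s) * (frame_vector e \<beta> \<bullet> e s))"
    by (simp add: inner_sum_left inner_commute[of "e _"])
  then show ?thesis
    by (simp add: frame_vector_component[OF frame] power2_eq_square ac_simps)
qed

lemma hyperplanar_moment_hyperplane_of:
  assumes axes: "principal_axes N m M J e" and mass: "total_mass N m \<noteq> 0" and "\<beta> \<noteq> 0"
  shows "hyperplanar_moment N m M (hyperplane_of (center_of_mass N m M) e \<beta>) =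
    ((\<Sum>s\<in>UNIV. J s * (\<beta> $ s)\<^sup>2) + total_mass N m) / (\<Sum>s\<in>UNIV. (\<beta> $ s)\<^sup>2)"
proof -
  let ?C = "center_of_mass N m M" and ?n = "frame_vector e \<beta>"
  have frame: "orthonormal_frame e"
    using axes by (simp add: principal_axes_def orthonormal_frame_def)
  have n: "?n \<noteq> 0"
    using frame_vector_eq_0_iff[OF frame] \<open>\<beta> \<noteq> 0\<close> by simp
  have "(infdist X (hyperplane_of ?C e \<beta>))\<^sup>2 = (?n \<bullet> (X - ?C) - 1)\<^sup>2 / (\<Sum>s\<in>UNIV. (\<beta> $ s)\<^sup>2)"
    for X
    unfolding hyperplane_of_eq_affine infdist_hyperplane[OF n]
      frame_vector_inner_self[OF frame, symmetric] dot_square_norm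
    by (simp add: power_divide inner_diff_right algebra_simps)
  then show ?thesis
    using sum_squares_about_center[OF mass, where M = M and n = ?n]
    by (simp add: hyperplanar_moment_def sum_divide_distrib[symmetric]
        central_operator_diagonal[OF axes])
qed

section \<open>Diagonal quadrics and their duals\<close>

lemma quadratic_polynomial_diagonal:
  fixes d :: "'n::finite \<Rightarrow> real"
  assumes "d t \<noteq> 0"
  shows "quadratic_polynomial (\<lambda>\<beta> :: real^'n. (\<Sum>s\<in>UNIV. d s * (\<beta> $ s)\<^sup>2) + c)"
proof -
  define A :: "real^'n^'n" where "A = (\<chi> i j. if i = j then d i else 0)"
  have "transpose A = A"
    by (simp add: A_def transpose_def vec_eq_iff)
  moreover have "A \<noteq> 0"
    using assms by (auto simp: A_def vec_eq_iff)
  moreover have "x \<bullet> (A *v x) = (\<Sum>s\<in>UNIV. d s * (x $ s)\<^sup>2)" for x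
    by (simp add: A_def inner_vec_def matrix_vector_mult_def power2_eq_square mult.left_commute
        if_distrib[of "\<lambda>y. y * _"] cong: if_cong)
  ultimately show ?thesis
    unfolding quadratic_polynomial_def by (intro exI[of _ A] exI[of _ 0] exI[of _ c]) simp
qed

lemma GDERIV_unique:
  assumes "GDERIV f x :> g" and "GDERIV f x :> h"
  shows "g = h"
proof -
  have "(\<lambda>y. y \<bullet> g) = (\<lambda>y. y \<bullet> h)"
    using assms unfolding gderiv_def by (rule has_derivative_unique)
  then show ?thesis
    by (metis vector_eq_ldot)
qed

lemma GDERIV_diagonal:
  "GDERIV (\<lambda>X. (\<Sum>s\<in>UNIV. (coords C e X $ s)\<^sup>2 / D s) - 1) P :>
    2 *\<^sub>R frame_vector e (\<chi> s. coords C e P $ s / D s)"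
  unfolding gderiv_def coords_def
  by (auto intro!: derivative_eq_intros
      simp: inner_commute[of _ "frame_vector _ _"] frame_vector_inner sum_distrib_left
        ac_simps divide_inverse)

text \<open>The gradient at \<open>P\<close> is twice the vector with components \<open>x\<^sub>s / D s\<close>, and its inner product
  with \<open>P - C\<close> is 2 by the equation of the quadric. Hence \<open>\<beta>\<^sub>s = x\<^sub>s / D s\<close> are the coordinates of
  the tangent hyperplane, and \<open>\<Sum>s. x\<^sub>s\<^sup>2 / D s\<close> turns into \<open>\<Sum>s. D s * \<beta>\<^sub>s\<^sup>2\<close>. Conversely, the point
  of tangency is recovered from \<open>x\<^sub>s = D s * \<beta>\<^sub>s\<close>.\<close>

lemma tangent_hyperplanes_diagonal:
  assumes frame: "orthonormal_frame e" and D: "\<And>s. D s \<noteq> 0"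
  shows "tangent_hyperplanes (\<lambda>X. (\<Sum>s\<in>UNIV. (coords C e X $ s)\<^sup>2 / D s) - 1) =
    hyperplane_locus C e (\<lambda>\<beta>. (\<Sum>s\<in>UNIV. D s * (\<beta> $ s)\<^sup>2) - 1)"
    (is "tangent_hyperplanes ?f = hyperplane_locus C e ?Q")
proof -
  define dual where "dual P = (\<chi> s. coords C e P $ s / D s)" for P
  have gradient: "GDERIV ?f P :> 2 *\<^sub>R frame_vector e (dual P)" for P
    unfolding dual_def by (rule GDERIV_diagonal)
  have Q_dual: "?Q (dual P) = ?f P" for P
    using D by (simp add: dual_def power2_eq_square)
  have tangent: "{X. (2 *\<^sub>R frame_vector e (dual P)) \<bullet> (X - P) = 0} = hyperplane_of C e (dual P)"
    if "?f P = 0" for P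
  proof -
    have "frame_vector e (dual P) \<bullet> (P - C) = 1"
      using that by (simp add: frame_vector_inner dual_def coords_def power2_eq_square)
    then have "frame_vector e (dual P) \<bullet> (X - P) = frame_vector e (dual P) \<bullet> (X - C) - 1" for X
      by (simp add: inner_diff_right)
    then show ?thesis
      by (auto simp: hyperplane_of_eq)
  qed
  have dual_nonzero: "dual P \<noteq> 0" if "?f P = 0" for P
  proof
    assume "dual P = 0"
    with Q_dual[of P] that show False
      by simp
  qed
  have dual_surj: "\<exists>P. dual P = \<beta>" for \<beta>
  proof
    let ?x = "\<chi> s. D s * \<beta> $ s"
    show "dual (C + frame_vector e ?x) = \<beta>"
      using D by (simp add: dual_def coords_def frame_vector_component[OF frame] vec_eq_iff)
  qed
  show ?thesis
  proof (intro equalityI subsetI)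
    fix \<pi> assume "\<pi> \<in> tangent_hyperplanes ?f"
    then obtain P g where P: "?f P = 0" and g: "GDERIV ?f P :> g" and \<pi>: "\<pi> = {X. g \<bullet> (X - P) = 0}"
      unfolding tangent_hyperplanes_def by blast
    have "\<pi> = hyperplane_of C e (dual P)"
      unfolding \<pi> GDERIV_unique[OF g gradient] by (rule tangent[OF P])
    then show "\<pi> \<in> hyperplane_locus C e ?Q"
      unfolding hyperplane_locus_def using P Q_dual[of P] dual_nonzero[OF P] by auto
  next
    fix \<pi> assume "\<pi> \<in> hyperplane_locus C e ?Q"
    then obtain \<beta> where \<beta>: "\<beta> \<noteq> 0" "?Q \<beta> = 0" and \<pi>: "\<pi> = hyperplane_of C e \<beta>"
      unfolding hyperplane_locus_def by blast
    obtain P where P: "dual P = \<beta>"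
      using dual_surj by blast
    have f: "?f P = 0"
      using Q_dual[of P] \<beta> P by simp
    have "2 *\<^sub>R frame_vector e (dual P) \<noteq> 0"
      using \<beta> P frame_vector_eq_0_iff[OF frame] by simp
    then show "\<pi> \<in> tangent_hyperplanes ?f"
      unfolding tangent_hyperplanes_def using f gradient[of P] tangent[OF f] P \<pi> by blast
  qed
qed

section \<open>The pencil of hyperplanes of constant moment\<close>

theorem theorem3p2:
  fixes N :: nat
    and m :: "nat \<Rightarrow> real"
    and M :: "nat \<Rightarrow> (real, 'n::{finite,linorder}) vec"
    and J :: "'n \<Rightarrow> real"
    and e :: "'n \<Rightarrow> (real, 'n) vec"
    and C :: "(real, 'n) vec"
    and mass :: real
    and a :: "'n \<Rightarrow> real"
    and family :: "real \<Rightarrow> ((real, 'n) vec) set set"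
  assumes masses_pos: "\<And>j. j \<in> {1..N} \<Longrightarrow> m j > 0"
    and not_in_hyperplane: "\<not> (\<exists>\<pi>. is_hyperplane \<pi> \<and> (\<forall>j\<in>{1..N}. M j \<in> \<pi>))"
    and mass_def: "mass = total_mass N m"
    and C_def: "C = center_of_mass N m M"
    and axes: "principal_axes N m M J e"
    and J_pos: "0 < J first_axis"
    and J_increasing: "strict_mono J"
    and a_squared: "\<And>s. s \<noteq> first_axis \<Longrightarrow> (a s)\<^sup>2 = (J s - J first_axis) / mass"
    and family_def: "\<And>\<mu>. family \<mu> =
      {\<pi>. is_hyperplane \<pi> \<and> hyperplanar_moment N m M \<pi> = \<mu> \<and> C \<notin> \<pi>}"
  shows "(\<forall>\<mu>. forms_quadric C e (family \<mu>)) \<and>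
    (\<exists>Q0 Q1. spans_linear_pencil Q0 Q1 \<and>
      (\<forall>\<mu>. family \<mu> = hyperplane_locus C e (pencil_member Q0 Q1 \<mu>)) \<and>
      (\<forall>l. confocal_nondegenerate (J first_axis / mass) a l \<longrightarrow>
        tangent_hyperplanes (confocal_polynomial C e (J first_axis / mass) a l) =
          hyperplane_locus C e (pencil_member Q0 Q1 (2 * J first_axis - mass * l))))"
proof -
  have frame: "orthonormal_frame e"
    using axes by (simp add: principal_axes_def orthonormal_frame_def)
  have mass: "mass > 0"
    unfolding mass_def using masses_pos not_in_hyperplane by (rule total_mass_pos)
  \<comment> \<open>\<open>Q1\<close> is \<open>- \<Sum>s. \<beta>\<^sub>s\<^sup>2\<close>, written as a diagonal form plus a constant.\<close>
  define Q0 Q1 :: "(real, 'n) vec \<Rightarrow> real"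
    where "Q0 = (\<lambda>\<beta>. (\<Sum>s\<in>UNIV. J s * (\<beta> $ s)\<^sup>2) + mass)"
      and "Q1 = (\<lambda>\<beta>. (\<Sum>s\<in>UNIV. (- 1) * (\<beta> $ s)\<^sup>2) + 0)"
  have member: "pencil_member Q0 Q1 \<mu> = (\<lambda>\<beta>. (\<Sum>s\<in>UNIV. (J s - \<mu>) * (\<beta> $ s)\<^sup>2) + mass)" for \<mu>
    by (rule ext) (simp add: pencil_member_def Q0_def Q1_def left_diff_distrib sum_subtractf
        sum_distrib_left sum_negf)
  have family_pencil: "family \<mu> = hyperplane_locus C e (pencil_member Q0 Q1 \<mu>)" for \<mu>
  proof -
    have moment: "hyperplanar_moment N m M (hyperplane_of C e \<beta>) = \<mu> \<longleftrightarrow> pencil_member Q0 Q1 \<mu> \<beta> = 0"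
      if "\<beta> \<noteq> 0" for \<beta>
      using hyperplanar_moment_hyperplane_of[OF axes _ that] sum_squares_components_pos[OF that] mass
      by (auto simp: C_def mass_def pencil_member_def Q0_def Q1_def sum_negf divide_eq_eq)
    have "family \<mu> = {\<pi> \<in> hyperplane_of C e ` {\<beta>. \<beta> \<noteq> 0}. hyperplanar_moment N m M \<pi> = \<mu>}"
      unfolding family_def hyperplanes_off_origin[OF frame, symmetric] by blast
    also have "\<dots> = hyperplane_locus C e (pencil_member Q0 Q1 \<mu>)"
      unfolding hyperplane_locus_def using moment by auto
    finally show ?thesis .
  qed
  have "forms_quadric C e (family \<mu>)" for \<mu>
  proof (cases "\<exists>t. J t \<noteq> \<mu>")
    case True
    then obtain t where "J t - \<mu> \<noteq> 0"
      by auto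
    then have "quadratic_polynomial (pencil_member Q0 Q1 \<mu>)"
      unfolding member by (rule quadratic_polynomial_diagonal)
    then show ?thesis
      unfolding forms_quadric_def family_pencil by blast
  next
    \<comment> \<open>This happens on a line only, where \<open>\<mu>\<close> is the single principal moment. The equation of
      the pencil is then \<open>mass = 0\<close>; its empty locus is also that of a polynomial of degree two.\<close>
    case False
    let ?Q = "\<lambda>\<beta> :: (real, 'n) vec. (\<Sum>s\<in>UNIV. 1 * (\<beta> $ s)\<^sup>2) + 1"
    have "?Q \<beta> \<noteq> 0" for \<beta>
      using sum_nonneg[of UNIV "\<lambda>s. (\<beta> $ s)\<^sup>2"] by (simp add: add_nonneg_eq_0_iff)
    then have "family \<mu> = hyperplane_locus C e ?Q"
      unfolding family_pencil member hyperplane_locus_def using False mass by simp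
    moreover have "quadratic_polynomial ?Q"
      by (rule quadratic_polynomial_diagonal) simp
    ultimately show ?thesis
      unfolding forms_quadric_def by blast
  qed
  moreover have "spans_linear_pencil Q0 Q1"
    unfolding spans_linear_pencil_def
  proof (intro conjI allI impI)
    show "quadratic_polynomial Q0"
      unfolding Q0_def using J_pos by (intro quadratic_polynomial_diagonal[of _ first_axis]) simp
    show "quadratic_polynomial Q1"
      unfolding Q1_def by (rule quadratic_polynomial_diagonal) simp
    fix u v assume zero: "\<forall>\<beta>. u * Q0 \<beta> + v * Q1 \<beta> = 0"
    show u: "u = 0"
      using zero[rule_format, of 0] mass by (simp add: Q0_def Q1_def)
    have "Q1 (\<chi> s. 1) \<noteq> 0"
      by (simp add: Q1_def)
    then show "v = 0"
      using zero[rule_format, of "\<chi> s. 1"] u by simp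
  qed
  moreover have "tangent_hyperplanes (confocal_polynomial C e (J first_axis / mass) a l) =
      hyperplane_locus C e (pencil_member Q0 Q1 (2 * J first_axis - mass * l))"
    if nondegenerate: "confocal_nondegenerate (J first_axis / mass) a l" for l
  proof -
    define D where "D = confocal_denominator (J first_axis / mass) a l"
    define \<mu> where "\<mu> = 2 * J first_axis - mass * l"
    have D: "D s \<noteq> 0" for s
      using nondegenerate by (simp add: confocal_nondegenerate_def D_def)
    have "J s - \<mu> = - mass * D s" for s
      using mass a_squared[of s]
      by (simp add: D_def confocal_denominator_def \<mu>_def right_diff_distrib diff_divide_distrib)
    then have "pencil_member Q0 Q1 \<mu> \<beta> = - mass * ((\<Sum>s\<in>UNIV. D s * (\<beta> $ s)\<^sup>2) - 1)" for \<beta>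
      by (simp add: member sum_distrib_left sum_negf right_diff_distrib mult.assoc)
    then have "hyperplane_locus C e (pencil_member Q0 Q1 \<mu>) =
        hyperplane_locus C e (\<lambda>\<beta>. (\<Sum>s\<in>UNIV. D s * (\<beta> $ s)\<^sup>2) - 1)"
      unfolding hyperplane_locus_def using mass by simp
    also have "\<dots> = tangent_hyperplanes (confocal_polynomial C e (J first_axis / mass) a l)"
      unfolding confocal_polynomial_def D_def[symmetric]
      by (rule tangent_hyperplanes_diagonal[OF frame D, symmetric])
    finally show ?thesis
      by (simp add: \<mu>_def)
  qed
  ultimately show ?thesis
    using family_pencil by blast
qed

end
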